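(* Let $G$ be a graph with $u \in V(G)$, and let $P_n$ be a path on $n$ vertices that is vertex-disjoint from $G$, with $v$ an endvertex of $P_n$. Suppose that $G$ admits a graceful labeling $f$ such that \[ f(u) + \left\lfloor \frac{n}{2} \right\rfloor + 1 \leq n, \] and that $n \not\equiv 1 \pmod{4}$. Then $G(u)\oplus P_n(v)$ admits a graceful labeling $h$ such that \[ h(w) = f(w) + \left\lfloor \frac{n}{2} \right\rfloor \quad \text{for all } w \in V(G). \]
   Context: For integers $p,q$, $[p,q]=\{i\in\mathbb{Z}: p\le i\le q\}$. A graceful labeling of a graph $G$ is an injective function $f:V(G)\to[0,|E(G)|]$ such that $\{|f(x)-f(y)| : xy\in E(G)\}=[1,|E(G)|]$. For vertex-disjoint graphs $G$ and $H$ with $u\in V(G)$ and $v\in V(H)$, $G(u)\oplus H(v)$ denotes the graph obtained from the disjoint union of $G$ and $H$ by adding the edge $uv$. *)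

theory Defs
  imports Complex_Main
begin

record 'a ugraph =
  verts :: "'a set"
  edges :: "'a set set"

definition simple_graph :: "'a ugraph \<Rightarrow> bool" where
  "simple_graph G \<longleftrightarrow> finite (verts G) \<and> edges G \<subseteq> {{x, y} | x y. x \<in> verts G \<and> y \<in> verts G \<and> x \<noteq> y}"

definition graceful :: "'a ugraph \<Rightarrow> ('a \<Rightarrow> int) \<Rightarrow> bool" where
  "graceful G f \<longleftrightarrow>
     inj_on f (verts G) \<and>
     f ` verts G \<subseteq> {0..int (card (edges G))} \<and>
     {\<bar>f x - f y\<bar> | x y. {x, y} \<in> edges G} = {1..int (card (edges G))}"

definition path_graph :: "'a list \<Rightarrow> 'a ugraph" where
  "path_graph xs = \<lparr>verts = set xs, edges = {{xs ! i, xs ! Suc i} | i. Suc i < length xs}\<rparr>"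

definition is_path :: "nat \<Rightarrow> 'a ugraph \<Rightarrow> bool" where
  "is_path n P \<longleftrightarrow> (\<exists>xs. distinct xs \<and> length xs = n \<and> P = path_graph xs)"

definition path_endvertex :: "'a ugraph \<Rightarrow> 'a \<Rightarrow> bool" where
  "path_endvertex P v \<longleftrightarrow>
     (\<exists>xs. xs \<noteq> [] \<and> distinct xs \<and> P = path_graph xs \<and> (v = hd xs \<or> v = last xs))"

text \<open>The operation \<open>G(u) \<oplus> H(v)\<close>; it is meaningful only for vertex-disjoint \<open>G\<close> and \<open>H\<close> with
  \<open>u \<in> verts G\<close> and \<open>v \<in> verts H\<close>.\<close>

definition edge_join :: "'a ugraph \<Rightarrow> 'a \<Rightarrow> 'a ugraph \<Rightarrow> 'a \<Rightarrow> 'a ugraph" where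
  "edge_join G u H v =
     \<lparr>verts = verts G \<union> verts H, edges = edges G \<union> edges H \<union> {{u, v}}\<rparr>"

end

theory Submission
  imports Defs
begin

text \<open>
  Write \<open>k = \<lfloor>n/2\<rfloor>\<close> and \<open>m = |E(G)|\<close>. Shifting \<open>f\<close> by \<open>k\<close> leaves exactly the labels \<open>[0, k - 1]\<close> and
  \<open>[m + k + 1, m + n]\<close> for the path. We let the path alternate between high labels \<open>m + k + 1 + x\<close> and
  low labels \<open>k - 1 - y\<close>, so that an edge gets the label \<open>m + 2 + (x + y)\<close>; the joining edge gets
  the label \<open>m + 1\<close> exactly when the path starts with \<open>x = f(u)\<close>. It remains to find an alternating sequence of
  \<open>x\<close>'s and \<open>y\<close>'s with prescribed start \<open>b\<close>, exhausting \<open>[0, \<lceil>n/2\<rceil> - 1]\<close> and \<open>[0, \<lfloor>n/2\<rfloor> - 1]\<close>, whose consecutive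
  sums exhaust \<open>[0, n - 2]\<close>. Up to reflection, \<open>b\<close> is in the lower half of its range. Descend by steps of one from \<open>b\<close>
  to \<open>0\<close> on both sides; this uses up an initial segment of the sums, and what is left is,
  after translation, the same problem with the same start \<open>b\<close> for a shorter sequence. The descent fails only for
  \<open>n = 4 b + 1\<close> with \<open>b > 0\<close>.
\<close>

section \<open>Alternating sequences with prescribed start and consecutive sums\<close>

text \<open>Even positions carry the x's, odd positions the y's. There are
  \<open>(n + 1) div 2\<close> and \<open>n div 2\<close> such positions, so the bounds and
  injectivity within each parity force both ranges to be exhausted.\<close>

definition zigzag :: "nat \<Rightarrow> nat \<Rightarrow> (nat \<Rightarrow> nat) \<Rightarrow> bool" where
  "zigzag n b s \<longleftrightarrow>
     s 0 = b \<and>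
     (\<forall>i<n. s i < (if even i then (n + 1) div 2 else n div 2)) \<and>
     (\<forall>i<n. \<forall>j<n. even i = even j \<longrightarrow> s i = s j \<longrightarrow> i = j) \<and>
     (\<forall>t. Suc t < n \<longrightarrow> (\<exists>i. Suc i < n \<and> s i + s (Suc i) = t))"

lemma zigzag_start: "zigzag n b s \<Longrightarrow> s 0 = b"
  by (simp add: zigzag_def)

lemma zigzag_less:
  "zigzag n b s \<Longrightarrow> i < n \<Longrightarrow> s i < (if even i then (n + 1) div 2 else n div 2)"
  by (simp add: zigzag_def)

lemma zigzag_inj:
  "zigzag n b s \<Longrightarrow> i < n \<Longrightarrow> j < n \<Longrightarrow> even i = even j \<Longrightarrow> s i = s j \<Longrightarrow> i = j"
  unfolding zigzag_def by blast

lemma zigzag_sum: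
  assumes "zigzag n b s" "Suc t < n"
  obtains i where "Suc i < n" "s i + s (Suc i) = t"
  using assms unfolding zigzag_def by blast

text \<open>The two bounds add up to \<open>n\<close>, so complementing each entry in its range
  turns an adjacent sum \<open>t\<close> into \<open>n - 2 - t\<close>, a symmetry of the required
  sums.\<close>

lemma zigzag_reflect:
  assumes s: "zigzag n b s" and "n > 0"
  shows "zigzag n ((n + 1) div 2 - 1 - b)
    (\<lambda>i. (if even i then (n + 1) div 2 else n div 2) - 1 - s i)"
  unfolding zigzag_def
proof (intro conjI allI impI)
  fix i assume "i < n"
  from zigzag_less[OF s this]
  show "(if even i then (n + 1) div 2 else n div 2) - 1 - s i
      < (if even i then (n + 1) div 2 else n div 2)"
    by (simp split: if_splits)
next
  fix i j assume "i < n" "j < n" "even i = even j"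
    "(if even i then (n + 1) div 2 else n div 2) - 1 - s i =
     (if even j then (n + 1) div 2 else n div 2) - 1 - s j"
  with zigzag_less[OF s, of i] zigzag_less[OF s, of j] have "s i = s j"
    by (simp split: if_splits)
  with zigzag_inj[OF s] \<open>i < n\<close> \<open>j < n\<close> \<open>even i = even j\<close> show "i = j" by blast
next
  fix t assume t: "Suc t < n"
  then have "Suc (n - 2 - t) < n" by simp
  from zigzag_sum[OF s this] obtain i where i: "Suc i < n" "s i + s (Suc i) = n - 2 - t" .
  have "(n + 1) div 2 + n div 2 = n" by presburger
  with i t zigzag_less[OF s, of i] zigzag_less[OF s, of "Suc i"]
  have "((if even i then (n + 1) div 2 else n div 2) - 1 - s i) +
    ((if even (Suc i) then (n + 1) div 2 else n div 2) - 1 - s (Suc i)) = t"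
    by (cases "even i") auto
  with i show "\<exists>i. Suc i < n \<and> ((if even i then (n + 1) div 2 else n div 2) - 1 - s i) +
    ((if even (Suc i) then (n + 1) div 2 else n div 2) - 1 - s (Suc i)) = t"
    by blast
qed (use zigzag_start[OF s] in simp)

text \<open>The prefix \<open>b, b-1, b-1, ..., 0, 0\<close> has the sums
  \<open>2b-1, ..., 0\<close>, and its last 0 meets \<open>s 0 + b = 2b\<close>. Being of odd length
  it swaps the parities in \<open>s\<close>. It uses up \<open>b\<close> odd and
  \<open>b + 1\<close> even positions, hence the raise by \<open>b\<close> or \<open>b + 1\<close>;
  the sums of \<open>s\<close> rise by \<open>2b + 1\<close>.\<close>

lemma zigzag_extend_odd:
  assumes s: "zigzag n b s" and "n > 0"
  shows "zigzag (n + 2 * b + 1) b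
    (\<lambda>i. if i < 2 * b + 1 then b - (i + 1) div 2
         else s (i - (2 * b + 1)) + b + (if even i then 1 else 0))"
    (is "zigzag ?n b ?s")
  unfolding zigzag_def
proof (intro conjI allI impI)
  fix i assume i: "i < ?n"
  show "?s i < (if even i then (?n + 1) div 2 else ?n div 2)"
  proof (cases "i < 2 * b + 1")
    case True
    then show ?thesis using \<open>n > 0\<close> by (cases "even i") (auto elim!: evenE oddE)
  next
    case False
    define j where "j = i - (2 * b + 1)"
    have j: "i = j + (2 * b + 1)" "j < n" using False i by (auto simp: j_def)
    have "(?n + 1) div 2 = n div 2 + b + 1" "?n div 2 = (n + 1) div 2 + b" by presburger+
    then show ?thesis using zigzag_less[OF s j(2)] unfolding j(1) by auto
  qed
next
  fix i j assume i: "i < ?n" and j: "j < ?n" and par: "even i = even j" and eq: "?s i = ?s j"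
  consider "i < 2 * b + 1" "j < 2 * b + 1" | "i < 2 * b + 1" "\<not> j < 2 * b + 1"
    | "\<not> i < 2 * b + 1" "j < 2 * b + 1" | "\<not> i < 2 * b + 1" "\<not> j < 2 * b + 1" by blast
  then show "i = j"
  proof cases
    case 1
    then have "b - (i + 1) div 2 = b - (j + 1) div 2" using eq by simp
    then show ?thesis using 1 par by (cases "even i") (auto elim!: evenE oddE)
  next
    case 2
    then have "b - (i + 1) div 2 = s (j - (2 * b + 1)) + b + (if even j then 1 else 0)"
      using eq by (simp only: if_True if_False)
    \<comment> \<open>The left side is at most \<open>b\<close>, the right side at least
      \<open>b\<close>, so only \<open>i = 0\<close> survives. Then \<open>j\<close> is even, and
      its extra 1 is the contradiction.\<close>
    moreover from this have "(i + 1) div 2 = 0 \<or> b = 0" by linarith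
    then have "i = 0" using 2 by auto
    ultimately show ?thesis using par by simp
  next
    case 3
    then have "b - (j + 1) div 2 = s (i - (2 * b + 1)) + b + (if even i then 1 else 0)"
      using eq[symmetric] by (simp only: if_True if_False)
    moreover from this have "(j + 1) div 2 = 0 \<or> b = 0" by linarith
    then have "j = 0" using 3 by auto
    ultimately show ?thesis using par by simp
  next
    case 4
    then have "s (i - (2 * b + 1)) = s (j - (2 * b + 1))" using eq par by simp
    moreover have "even (i - (2 * b + 1)) = even (j - (2 * b + 1))" using 4 par by simp
    ultimately have "i - (2 * b + 1) = j - (2 * b + 1)"
      using zigzag_inj[OF s, of "i - (2 * b + 1)" "j - (2 * b + 1)"] i j 4 by linarith
    then show ?thesis using 4 by linarith
  qed
next
  fix t assume t: "Suc t < ?n"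
  consider "t < 2 * b" | "t = 2 * b" | "t \<ge> 2 * b + 1" by linarith
  then show "\<exists>i. Suc i < ?n \<and> ?s i + ?s (Suc i) = t"
  proof cases
    case 1
    \<comment> \<open>Inside the prefix the sum at position \<open>i\<close> is
      \<open>2b - 1 - i\<close>.\<close>
    define i where "i = 2 * b - 1 - t"
    have i: "i < 2 * b" "i + t + 1 = 2 * b" using 1 by (auto simp: i_def)
    have "(i + 1) div 2 + (Suc i + 1) div 2 = i + 1" by presburger
    moreover have "(i + 1) div 2 \<le> b" "(Suc i + 1) div 2 \<le> b" using i(1) by auto
    ultimately have "(b - (i + 1) div 2) + (b - (Suc i + 1) div 2) = t" using i(2) by linarith
    then show ?thesis using i(1) by (intro exI[of _ i]) simp
  next
    case 2
    then show ?thesis using \<open>n > 0\<close> zigzag_start[OF s] by (intro exI[of _ "2 * b"]) simp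
  next
    case 3
    then have "Suc (t - (2 * b + 1)) < n" using t by simp
    from zigzag_sum[OF s this] obtain i where "Suc i < n" "s i + s (Suc i) = t - (2 * b + 1)" .
    then show ?thesis using 3 by (intro exI[of _ "i + (2 * b + 1)"]) (auto simp: Suc_diff_le)
  qed
qed simp

text \<open>The prefix \<open>b, b, b-1, b-1, ..., 0, 0\<close> has the sums
  \<open>2b, ..., 0\<close>. It preserves parity and uses up \<open>b + 1\<close> values on each
  side, so all of \<open>s\<close> is raised by \<open>b + 1\<close>; the seam has sum
  \<open>2b + 1\<close>.\<close>

lemma zigzag_extend_even:
  assumes s: "zigzag n b s" and "n > 0"
  shows "zigzag (n + 2 * b + 2) b
    (\<lambda>i. if i < 2 * b + 2 then b - i div 2 else s (i - (2 * b + 2)) + b + 1)"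
    (is "zigzag ?n b ?s")
  unfolding zigzag_def
proof (intro conjI allI impI)
  fix i assume i: "i < ?n"
  show "?s i < (if even i then (?n + 1) div 2 else ?n div 2)"
  proof (cases "i < 2 * b + 2")
    case True
    then show ?thesis using \<open>n > 0\<close> by auto
  next
    case False
    define j where "j = i - (2 * b + 2)"
    have j: "i = j + (2 * b + 2)" "j < n" using False i by (auto simp: j_def)
    have "(?n + 1) div 2 = (n + 1) div 2 + b + 1" "?n div 2 = n div 2 + b + 1" by presburger+
    then show ?thesis using zigzag_less[OF s j(2)] unfolding j(1) by auto
  qed
next
  fix i j assume i: "i < ?n" and j: "j < ?n" and par: "even i = even j" and eq: "?s i = ?s j"
  consider "i < 2 * b + 2" "j < 2 * b + 2" | "i < 2 * b + 2" "\<not> j < 2 * b + 2"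
    | "\<not> i < 2 * b + 2" "j < 2 * b + 2" | "\<not> i < 2 * b + 2" "\<not> j < 2 * b + 2" by blast
  then show "i = j"
  proof cases
    case 1
    then have "b - i div 2 = b - j div 2" using eq by simp
    then show ?thesis using 1 par by (cases "even i") (auto elim!: evenE oddE)
  next
    case 4
    then have "s (i - (2 * b + 2)) = s (j - (2 * b + 2))" using eq by simp
    moreover have "even (i - (2 * b + 2)) = even (j - (2 * b + 2))" using 4 par by simp
    ultimately have "i - (2 * b + 2) = j - (2 * b + 2)"
      using zigzag_inj[OF s, of "i - (2 * b + 2)" "j - (2 * b + 2)"] i j 4 by linarith
    then show ?thesis using 4 by linarith
  qed (use eq in simp_all)
next
  fix t assume t: "Suc t < ?n"
  consider "t < 2 * b + 1" | "t = 2 * b + 1" | "t \<ge> 2 * b + 2" by linarith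
  then show "\<exists>i. Suc i < ?n \<and> ?s i + ?s (Suc i) = t"
  proof cases
    case 1
    define i where "i = 2 * b - t"
    have i: "i < 2 * b + 1" "i + t = 2 * b" using 1 by (auto simp: i_def)
    have "i div 2 + Suc i div 2 = i" by presburger
    moreover have "i div 2 \<le> b" "Suc i div 2 \<le> b" using i(1) by auto
    ultimately have "(b - i div 2) + (b - Suc i div 2) = t" using i(2) by linarith
    then show ?thesis using i(1) by (intro exI[of _ i]) simp
  next
    case 2
    then show ?thesis using \<open>n > 0\<close> zigzag_start[OF s] by (intro exI[of _ "2 * b + 1"]) simp
  next
    case 3
    then have "Suc (t - (2 * b + 2)) < n" using t by simp
    from zigzag_sum[OF s this] obtain i where "Suc i < n" "s i + s (Suc i) = t - (2 * b + 2)" .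
    then show ?thesis using 3 by (intro exI[of _ "i + (2 * b + 2)"]) (auto simp: Suc_diff_le)
  qed
qed simp

text \<open>For \<open>n = 4b + 1\<close> with \<open>b > 0\<close>, the start is the midpoint of
  its range, fixed by reflection, and either prefix would leave too few terms for the start
  \<open>b\<close>.\<close>

lemma zigzag_exists:
  assumes "b < (n + 1) div 2" "n = 4 * b + 1 \<longrightarrow> b = 0"
  shows "\<exists>s. zigzag n b s"
  using assms
proof (induction n arbitrary: b rule: less_induct)
  case (less n)
  have lower: "\<exists>s. zigzag n b s" if b: "2 * b < (n + 1) div 2" "n = 4 * b + 1 \<longrightarrow> b = 0" for b
  proof -
    \<comment> \<open>An even remaining length never meets the exceptional case.\<close>
    have parity: "2 * q \<noteq> 4 * b + 1" for q by presburger
    consider "n = 1" | k where "n = 2 * k" "k = 2 * b + 1" | k where "n = 2 * k" "k > 2 * b + 1"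
      | k where "n = 2 * k + 1" "2 * b < k"
    proof (cases "even n")
      case True
      then obtain k where "n = 2 * k" by (elim evenE)
      then show ?thesis using that(2,3)[of k] b by linarith
    next
      case False
      then obtain k where "n = 2 * k + 1" by (elim oddE)
      then show ?thesis using that(1) that(4)[of k] b by force
    qed
    then show ?thesis
    proof cases
      case 1
      then have "zigzag n b (\<lambda>_. 0)" using b by (simp add: zigzag_def)
      then show ?thesis by blast
    next
      case 2
      \<comment> \<open>Here \<open>n = 4b + 2\<close>: the even prefix would leave only
        \<open>2b\<close> terms, too few for the start \<open>b\<close>, so the odd prefix is
        taken.\<close>
      have "\<exists>s. zigzag (2 * b + 1) b s" using 2 by (intro less.IH) auto
      then obtain s where s: "zigzag (2 * b + 1) b s" ..
      have n: "(2 * b + 1) + 2 * b + 1 = n" and pos: "2 * b + 1 > 0" using 2 by auto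
      show ?thesis by (rule exI, rule zigzag_extend_odd[OF s pos, unfolded n])
    next
      case 3
      have "\<exists>s. zigzag (2 * (k - b - 1)) b s" using 3 parity[of "k - b - 1"] by (intro less.IH) auto
      then obtain s where s: "zigzag (2 * (k - b - 1)) b s" ..
      have n: "2 * (k - b - 1) + 2 * b + 2 = n" and pos: "2 * (k - b - 1) > 0" using 3 by auto
      show ?thesis by (rule exI, rule zigzag_extend_even[OF s pos, unfolded n])
    next
      case 4
      have "\<exists>s. zigzag (2 * (k - b)) b s" using 4 parity[of "k - b"] by (intro less.IH) auto
      then obtain s where s: "zigzag (2 * (k - b)) b s" ..
      have n: "2 * (k - b) + 2 * b + 1 = n" and pos: "2 * (k - b) > 0" using 4 by auto
      show ?thesis by (rule exI, rule zigzag_extend_odd[OF s pos, unfolded n])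
    qed
  qed
  show ?case
  proof (cases "2 * b < (n + 1) div 2")
    case True
    then show ?thesis using lower less.prems(2) by blast
  next
    case False
    let ?c = "(n + 1) div 2 - 1 - b"
    have "2 * ?c < (n + 1) div 2" using False less.prems(1) by linarith
    \<comment> \<open>Equality would make \<open>b = ?c\<close> the midpoint, which counts as lower
      half.\<close>
    moreover have "n \<noteq> 4 * ?c + 1"
    proof
      assume "n = 4 * ?c + 1"
      then have "(n + 1) div 2 = 2 * ?c + 1" by linarith
      then show False using False less.prems(1) by linarith
    qed
    ultimately obtain s where s: "zigzag n ?c s" using lower by blast
    have c: "(n + 1) div 2 - 1 - ?c = b" and pos: "n > 0" using less.prems(1) by auto
    show ?thesis by (rule exI, rule zigzag_reflect[OF s pos, unfolded c])
  qed
qed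

section \<open>Paths and edge counts\<close>

lemma path_graph_rev: "path_graph (rev xs) = path_graph xs"
proof -
  have "edges (path_graph (rev xs)) \<subseteq> edges (path_graph xs)" for xs :: "'a list"
  proof
    fix e assume "e \<in> edges (path_graph (rev xs))"
    then obtain i where i: "Suc i < length xs" "e = {rev xs ! i, rev xs ! Suc i}"
      by (auto simp: path_graph_def)
    let ?j = "length xs - 2 - i"
    have "Suc ?j < length xs" "rev xs ! i = xs ! Suc ?j" "rev xs ! Suc i = xs ! ?j"
      using i(1) by (auto simp: rev_nth intro!: arg_cong[of _ _ "(!) xs"])
    then show "e \<in> edges (path_graph xs)"
      using i(2) by (auto simp: path_graph_def)
  qed
  from this[of xs] this[of "rev xs"] show ?thesis by (simp add: path_graph_def)
qed

lemma card_edges_path_graph: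
  assumes "distinct xs"
  shows "card (edges (path_graph xs)) = length xs - 1"
proof -
  have "edges (path_graph xs) = (\<lambda>i. {xs ! i, xs ! Suc i}) ` {..<length xs - 1}"
    by (auto simp: path_graph_def)
  moreover have "inj_on (\<lambda>i. {xs ! i, xs ! Suc i}) {..<length xs - 1}"
    using assms by (auto simp: inj_on_def doubleton_eq_iff nth_eq_iff_index_eq)
  ultimately show ?thesis by (simp add: card_image)
qed

text \<open>The lists witnessing the two assumptions may differ; counting vertices gives the length,
  and reversal puts \<open>v\<close> first.\<close>

lemma path_from_endvertex:
  assumes "is_path n P" "path_endvertex P v"
  obtains xs where "distinct xs" "length xs = n" "n > 0" "P = path_graph xs" "xs ! 0 = v"
proof -
  from assms(2) obtain ys where ys: "ys \<noteq> []" "distinct ys" "P = path_graph ys"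
    "v = hd ys \<or> v = last ys" by (auto simp: path_endvertex_def)
  have len: "length ys = n"
    using assms(1) ys(2,3) by (auto simp: is_path_def path_graph_def dest!: distinct_card)
  show thesis
  proof (cases "v = hd ys")
    case True
    then show ?thesis using that[of ys] ys len by (auto simp: hd_conv_nth)
  next
    case False
    then show ?thesis using that[of "rev ys"] ys len
      by (auto simp: path_graph_rev hd_conv_nth[symmetric] hd_rev)
  qed
qed

text \<open>The path has one edge less than vertices; the joining edge, which meets both sides and
  so is new, makes up for it.\<close>

lemma card_edges_edge_join:
  assumes G: "simple_graph G" and "u \<in> verts G" and xs: "distinct xs" "xs \<noteq> []"
    and disj: "verts G \<inter> set xs = {}" and "v \<in> set xs"
  shows "card (edges (edge_join G u (path_graph xs) v)) = card (edges G) + length xs"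
proof -
  have sub: "e \<subseteq> verts G" if "e \<in> edges G" for e
    using G that by (auto simp: simple_graph_def)
  have fin: "finite (edges G)"
    by (rule finite_subset[of _ "Pow (verts G)"]) (use G sub in \<open>auto simp: simple_graph_def\<close>)
  have P: "e \<subseteq> set xs \<and> e \<noteq> {}" if "e \<in> edges (path_graph xs)" for e
    using that by (auto simp: path_graph_def)
  have finP: "finite (edges (path_graph xs))"
    by (rule finite_subset[of _ "Pow (set xs)"]) (use P in auto)
  have "edges G \<inter> edges (path_graph xs) = {}" using sub P disj by blast
  moreover have "{u, v} \<notin> edges G" "{u, v} \<notin> edges (path_graph xs)"
    using sub P assms(2,6) disj by blast+
  ultimately show ?thesis
    using fin finP xs card_edges_path_graph[OF xs(1)]
    by (simp add: edge_join_def card_Un_disjoint)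
qed

section \<open>The labeling of the joined graph\<close>

theorem theorem1p3:
  fixes G P :: "'a ugraph" and u v :: 'a and n :: nat and f :: "'a \<Rightarrow> int"
  assumes "simple_graph G"
    and "u \<in> verts G"
    and "is_path n P"
    and "verts G \<inter> verts P = {}"
    and "path_endvertex P v"
    and "graceful G f"
    and "f u + \<lfloor>real n / 2\<rfloor> + 1 \<le> int n"
    and "n mod 4 \<noteq> 1"
  shows "\<exists>h. graceful (edge_join G u P v) h \<and> (\<forall>w \<in> verts G. h w = f w + \<lfloor>real n / 2\<rfloor>)"
proof -
  obtain xs where xs: "distinct xs" "length xs = n" "n > 0" "P = path_graph xs" "xs ! 0 = v"
    by (rule path_from_endvertex[OF assms(3,5)])
  have vP: "verts P = set xs" by (simp add: xs(4) path_graph_def)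
  have v: "v \<in> set xs" using xs by auto
  define k where "k = n div 2"
  have k: "\<lfloor>real n / 2\<rfloor> = int k"
    using floor_divide_of_nat_eq[of n 2, where 'a = real] by (simp add: k_def)
  have nk: "(n + 1) div 2 = n - k" "n div 2 = k" "k \<le> n" unfolding k_def by presburger+
  define m where "m = card (edges G)"
  have inj: "inj_on f (verts G)" and rng: "\<And>w. w \<in> verts G \<Longrightarrow> 0 \<le> f w \<and> f w \<le> int m"
    and lab: "{\<bar>f x - f y\<bar> | x y. {x, y} \<in> edges G} = {1..int m}"
    using assms(6) by (auto simp: graceful_def m_def)
  have edgeG: "x \<in> verts G \<and> y \<in> verts G" if "{x, y} \<in> edges G" for x y
    using assms(1) that by (auto simp: simple_graph_def doubleton_eq_iff)
  define b where "b = nat (f u)"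
  have b: "f u = int b" using rng[OF assms(2)] by (simp add: b_def)
  have "b < (n + 1) div 2" using assms(7) unfolding k b nk by linarith
  moreover have "n \<noteq> 4 * b + 1" using assms(8) by presburger
  ultimately obtain s where s: "zigzag n b s" using zigzag_exists by blast
  \<comment> \<open>Both kinds of label avoid \<open>[k, m + k]\<close>, where the shifted
    \<open>f\<close> takes its values.\<close>
  define g where "g i = (if even i then int m + int k + 1 + int (s i) else int k - 1 - int (s i))" for i
  have gE: "int m + int k + 1 \<le> g i \<and> g i \<le> int m + int n" if "i < n" "even i" for i
    using zigzag_less[OF s that(1)] that nk by (auto simp: g_def)
  have gO: "0 \<le> g i \<and> g i \<le> int k - 1" if "i < n" "odd i" for i
    using zigzag_less[OF s that(1)] that nk by (auto simp: g_def)
  have g_inj: "i = j" if "i < n" "j < n" "g i = g j" for i j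
  proof -
    have par: "even i = even j" using gE[of i] gE[of j] gO[of i] gO[of j] that by fastforce
    then have "s i = s j" using that(3) by (auto simp: g_def split: if_splits)
    then show ?thesis using zigzag_inj[OF s] that par by blast
  qed
  have g_diff: "\<bar>g i - g (Suc i)\<bar> = int m + 2 + int (s i + s (Suc i))" for i
    by (cases "even i") (auto simp: g_def)
  define h where "h w = (if w \<in> verts G then f w + int k else g (inv_into {..<n} ((!) xs) w))" for w
  have nth_inj: "inj_on ((!) xs) {..<n}"
    using xs(1,2) by (auto simp: inj_on_def nth_eq_iff_index_eq)
  have hG: "h w = f w + int k" if "w \<in> verts G" for w using that by (simp add: h_def)
  have hP: "h (xs ! i) = g i" if "i < n" for i
  proof -
    have "xs ! i \<in> set xs" using that xs(2) by simp
    then have "xs ! i \<notin> verts G" using assms(4) vP by blast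
    then show ?thesis using inv_into_f_f[OF nth_inj] that by (simp add: h_def)
  qed
  have hPE: "\<exists>i<n. w = xs ! i \<and> h w = g i" if "w \<in> set xs" for w
    using that hP xs(2) by (metis in_set_conv_nth)
  let ?J = "edge_join G u P v"
  have vJ: "verts ?J = verts G \<union> set xs" by (simp add: edge_join_def vP)
  have eJ: "edges ?J = edges G \<union> {{xs ! i, xs ! Suc i} | i. Suc i < n} \<union> {{u, v}}"
    by (simp add: edge_join_def xs(4) path_graph_def xs(2))
  have cJ: "card (edges ?J) = m + n"
    using card_edges_edge_join[OF assms(1,2) xs(1) _ _ v] assms(4) xs vP by (auto simp: m_def)
  \<comment> \<open>The labels are \<open>b + k\<close> and \<open>m + k + 1 + b\<close>, as the
    path starts with \<open>s 0 = b\<close>.\<close>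
  have join: "\<bar>h u - h v\<bar> = int m + 1"
    using hG[OF assms(2)] hP[OF xs(3)] zigzag_start[OF s] b xs(5) by (simp add: g_def)
  have cross: "h x \<noteq> h y" if x: "x \<in> verts G" and y: "y \<in> set xs" for x y
  proof -
    obtain i where "i < n" "h y = g i" using hPE[OF y] by blast
    then show ?thesis using hG[OF x] rng[OF x] gE[of i] gO[of i] by fastforce
  qed
  have "inj_on h (verts ?J)"
  proof (rule inj_onI)
    fix x y assume x: "x \<in> verts ?J" and y: "y \<in> verts ?J" and eq: "h x = h y"
    consider "x \<in> verts G" "y \<in> verts G" | "x \<in> set xs" "y \<in> set xs"
      using x y cross[of x y] cross[of y x] eq vJ by auto
    then show "x = y"
    proof cases
      case 1
      then show ?thesis using eq hG inj by (auto dest: inj_onD)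
    next
      case 2
      then show ?thesis using eq hPE g_inj by metis
    qed
  qed
  moreover have "h ` verts ?J \<subseteq> {0..int (m + n)}"
  proof
    fix z assume "z \<in> h ` verts ?J"
    then consider w where "w \<in> verts G" "z = h w" | i where "i < n" "z = g i"
      using vJ hPE by blast
    then show "z \<in> {0..int (m + n)}"
    proof cases
      case 1
      then show ?thesis using hG rng nk(3) by fastforce
    next
      case 2
      then show ?thesis using gE[of i] gO[of i] nk(3) by (cases "even i") auto
    qed
  qed
  moreover have "{\<bar>h x - h y\<bar> | x y. {x, y} \<in> edges ?J} = {1..int (m + n)}"
  proof (intro equalityI subsetI)
    fix d assume "d \<in> {\<bar>h x - h y\<bar> | x y. {x, y} \<in> edges ?J}"
    then obtain x y where d: "d = \<bar>h x - h y\<bar>" and e: "{x, y} \<in> edges ?J" by blast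
    consider "{x, y} \<in> edges G" | i where "Suc i < n" "{x, y} = {xs ! i, xs ! Suc i}"
      | "{x, y} = {u, v}" using e eJ by auto
    then show "d \<in> {1..int (m + n)}"
    proof cases
      case 1
      then have "d \<in> {\<bar>f x - f y\<bar> | x y. {x, y} \<in> edges G}" using d hG edgeG by fastforce
      then show ?thesis using lab by auto
    next
      case 2
      then have "d = \<bar>g i - g (Suc i)\<bar>" using d hP[of i] hP[of "Suc i"]
        by (auto simp: doubleton_eq_iff)
      \<comment> \<open>Adjacent positions have opposite parity, so their strict bounds add up to
        \<open>n\<close>.\<close>
      moreover have "s i + s (Suc i) + 2 \<le> n"
        using zigzag_less[OF s, of i] zigzag_less[OF s, of "Suc i"] 2(1) nk
        by (cases "even i") auto
      ultimately show ?thesis using g_diff[of i] by simp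
    next
      case 3
      then have "d = int m + 1" using d join by (auto simp: doubleton_eq_iff)
      then show ?thesis using xs(3) by simp
    qed
  next
    fix d assume d: "d \<in> {1..int (m + n)}"
    consider "d \<le> int m" | "d = int m + 1" | "d \<ge> int m + 2" by linarith
    then show "d \<in> {\<bar>h x - h y\<bar> | x y. {x, y} \<in> edges ?J}"
    proof cases
      case 1
      then have "d \<in> {\<bar>f x - f y\<bar> | x y. {x, y} \<in> edges G}" using d lab by auto
      then obtain x y where xy: "d = \<bar>f x - f y\<bar>" "{x, y} \<in> edges G" by blast
      then have "d = \<bar>h x - h y\<bar>" using hG edgeG by simp
      then show ?thesis using xy(2) eJ by blast
    next
      case 2
      then have "d = \<bar>h u - h v\<bar>" using join by simp
      then show ?thesis using eJ by blast
    next
      case 3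
      have "Suc (nat (d - int m - 2)) < n" using 3 d by simp
      from zigzag_sum[OF s this]
      obtain i where i: "Suc i < n" "s i + s (Suc i) = nat (d - int m - 2)" .
      then have "d = \<bar>h (xs ! i) - h (xs ! Suc i)\<bar>"
        using g_diff[of i] hP[of i] hP[of "Suc i"] 3 by simp
      then show ?thesis using i(1) eJ by blast
    qed
  qed
  ultimately have "graceful ?J h" unfolding graceful_def cJ by blast
  then show ?thesis using hG k by auto
qed

end
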